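(* The optimal delay-power tradeoff curve $\mathcal{L}$ is piecewise linear, decreasing, and convex.
   Context: Setting (single queue, adaptive transmitter, AWGN channel). $A,S,Q$ are positive integers with $S\ge A$ and $Q\ge A$. Arrivals $a[n]\in\{0,\dots,A\}$ form a stationary and ergodic Markov chain with transition probabilities $\gamma_{a,a'}$; $\alpha=\sum_a a\phi_a$ is the mean number of arrivals per slot, where $\phi$ is the stationary distribution. The queue length $q[n]\in\{0,\dots,Q\}$ evolves by $q[n+1]=q[n]-s[n]+a[n+1]$, where the transmission rate $s[n]\in\{0,\dots,S\}$ must lie in $\mathcal{S}(q)=\{s:\max\{q-Q+A,0\}\le s\le\min\{q,S\}\}$ with $q=q[n]$. $P(s)$, $0\le s\le S$, is the power consumed when transmitting $s$ packets; $P(0)=0$, and $P$ is monotonically increasing and convex in $s$. $\mathcal{G}$ is the set of all families $\{x_{q,a}^s:0\le q\le Q,0\le a\le A,0\le s\le S\}$ (state-action frequencies) with $x_{q,a}^s\ge0$, $x_{q,a}^s=0$ for $s\notin\mathcal{S}(q)$, $\sum_{q,a,s}x_{q,a}^s=1$, and $$\sum_{q=\max\{q'-a',0\}}^{\min\{q'-a'+S,Q\}}\sum_{a=0}^{A}\sum_{s=0}^{S}\gamma_{a,a'}x_{q,a}^s\mathbf{1}_{\{s=q+a'-q'\}}=\sum_{s=0}^{S}x_{q',a'}^s\quad\text{for all }0\le q'\le Q,\ 0\le a'\le A.$$ $\mathcal{R}$ is the set of pairs $(P,D)$ with $P=\sum_{q,a,s}P(s)x_{q,a}^s$ and $D=\frac1\alpha\sum_{q,a,s}q\,x_{q,a}^s$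 for some $\{x_{q,a}^s\}\in\mathcal{G}$ (all obtainable average power-delay pairs). The optimal delay-power tradeoff curve is $$\mathcal{L}=\{(P^*,D^* )\in\mathcal{R}:\ \text{for all }(\bar P,\bar D)\in\mathcal{R},\ \text{either }P^*\le\bar P\text{ or }D^*\le\bar D\}.$$ *)

theory Defs
  imports "HOL-Analysis.Analysis"
begin

definition stochastic :: "nat \<Rightarrow> (nat \<Rightarrow> nat \<Rightarrow> real) \<Rightarrow> bool" where
  "stochastic A \<gamma> \<longleftrightarrow>
     (\<forall>a\<le>A. \<forall>a'\<le>A. 0 \<le> \<gamma> a a') \<and> (\<forall>a\<le>A. (\<Sum>a'\<le>A. \<gamma> a a') = 1)"

text \<open>A stationary Markov chain on a finite state space is an ergodic process iff it is
  irreducible on its state space; aperiodicity is not required.\<close>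
definition ergodic_chain :: "nat \<Rightarrow> (nat \<Rightarrow> nat \<Rightarrow> real) \<Rightarrow> bool" where
  "ergodic_chain A \<gamma> \<longleftrightarrow> stochastic A \<gamma> \<and>
     (\<forall>a\<le>A. \<forall>a'\<le>A. (a, a') \<in> {(i, j). i \<le> A \<and> j \<le> A \<and> 0 < \<gamma> i j}\<^sup>*)"

definition stationary_distribution ::
    "nat \<Rightarrow> (nat \<Rightarrow> nat \<Rightarrow> real) \<Rightarrow> (nat \<Rightarrow> real) \<Rightarrow> bool" where
  "stationary_distribution A \<gamma> \<phi> \<longleftrightarrow>
     (\<forall>a\<le>A. 0 \<le> \<phi> a) \<and> (\<Sum>a\<le>A. \<phi> a) = 1 \<and>
     (\<forall>a'\<le>A. (\<Sum>a\<le>A. \<phi> a * \<gamma> a a') = \<phi> a')"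

definition mean_arrivals :: "nat \<Rightarrow> (nat \<Rightarrow> real) \<Rightarrow> real" where
  "mean_arrivals A \<phi> = (\<Sum>a\<le>A. real a * \<phi> a)"

definition convex_seq_upto :: "nat \<Rightarrow> (nat \<Rightarrow> real) \<Rightarrow> bool" where
  "convex_seq_upto S P \<longleftrightarrow> (\<forall>s. s + 2 \<le> S \<longrightarrow> P (s + 1) - P s \<le> P (s + 2) - P (s + 1))"

text \<open>Truncated subtraction turns \<open>q + A - Q\<close> into \<open>max {q - Q + A, 0}\<close>.\<close>
definition feasible_rates :: "nat \<Rightarrow> nat \<Rightarrow> nat \<Rightarrow> nat \<Rightarrow> nat set" where
  "feasible_rates A S Q q = {q + A - Q..min q S}"

text \<open>A family \<open>x\<close> is written \<open>x q a s\<close>; its values outside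
  \<open>q \<le> Q\<close>, \<open>a \<le> A\<close>, \<open>s \<le> S\<close> are never used. In the balance equation the lower
  limit \<open>q' - a'\<close> is truncated at 0, and \<open>q' + S - a'\<close> is an exact difference whenever
  \<open>A \<le> S\<close>; the indicator condition \<open>s = q + a' - q'\<close> is stated without subtraction.\<close>
definition frequencies ::
    "nat \<Rightarrow> nat \<Rightarrow> nat \<Rightarrow> (nat \<Rightarrow> nat \<Rightarrow> real) \<Rightarrow> (nat \<Rightarrow> nat \<Rightarrow> nat \<Rightarrow> real) set" where
  "frequencies A S Q \<gamma> = {x.
     (\<forall>q\<le>Q. \<forall>a\<le>A. \<forall>s\<le>S. 0 \<le> x q a s) \<and>
     (\<forall>q\<le>Q. \<forall>a\<le>A. \<forall>s\<le>S. s \<notin> feasible_rates A S Q q \<longrightarrow> x q a s = 0) \<and>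
     (\<Sum>q\<le>Q. \<Sum>a\<le>A. \<Sum>s\<le>S. x q a s) = 1 \<and>
     (\<forall>q'\<le>Q. \<forall>a'\<le>A.
        (\<Sum>q = q' - a'..min (q' + S - a') Q. \<Sum>a\<le>A. \<Sum>s\<le>S.
            \<gamma> a a' * x q a s * of_bool (s + q' = q + a'))
        = (\<Sum>s\<le>S. x q' a' s))}"

definition avg_power ::
    "nat \<Rightarrow> nat \<Rightarrow> nat \<Rightarrow> (nat \<Rightarrow> real) \<Rightarrow> (nat \<Rightarrow> nat \<Rightarrow> nat \<Rightarrow> real) \<Rightarrow> real" where
  "avg_power A S Q P x = (\<Sum>q\<le>Q. \<Sum>a\<le>A. \<Sum>s\<le>S. P s * x q a s)"

definition avg_delay ::
    "nat \<Rightarrow> nat \<Rightarrow> nat \<Rightarrow> real \<Rightarrow> (nat \<Rightarrow> nat \<Rightarrow> nat \<Rightarrow> real) \<Rightarrow> real" where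
  "avg_delay A S Q \<alpha> x = 1 / \<alpha> * (\<Sum>q\<le>Q. \<Sum>a\<le>A. \<Sum>s\<le>S. real q * x q a s)"

definition power_delay_region ::
    "nat \<Rightarrow> nat \<Rightarrow> nat \<Rightarrow> (nat \<Rightarrow> nat \<Rightarrow> real) \<Rightarrow> (nat \<Rightarrow> real) \<Rightarrow> (nat \<Rightarrow> real)
      \<Rightarrow> (real \<times> real) set" where
  "power_delay_region A S Q \<gamma> \<phi> P =
     (\<lambda>x. (avg_power A S Q P x, avg_delay A S Q (mean_arrivals A \<phi>) x)) `
       frequencies A S Q \<gamma>"

definition tradeoff_curve ::
    "nat \<Rightarrow> nat \<Rightarrow> nat \<Rightarrow> (nat \<Rightarrow> nat \<Rightarrow> real) \<Rightarrow> (nat \<Rightarrow> real) \<Rightarrow> (nat \<Rightarrow> real)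
      \<Rightarrow> (real \<times> real) set" where
  "tradeoff_curve A S Q \<gamma> \<phi> P =
     {(p, d) \<in> power_delay_region A S Q \<gamma> \<phi> P.
        \<forall>(p', d') \<in> power_delay_region A S Q \<gamma> \<phi> P. p \<le> p' \<or> d \<le> d'}"

text \<open>The tradeoff curve consists of weakly Pareto-optimal pairs, so it contains any vertical
  segment of pairs of minimal power and need not be the graph of a function of the power:
  for \<open>A = S = 1\<close> every pair has the same power. The three properties below are therefore
  stated for subsets of the plane (abscissa: power, ordinate: delay). Jointly they say
  that the set is the graph of a strictly decreasing, convex, piecewise linear function on a
  compact interval, possibly together with a vertical segment rising from its left
  endpoint.\<close>

text \<open>Consecutive vertices may coincide, so a single point is included.\<close>
definition piecewise_linear_curve :: "(real \<times> real) set \<Rightarrow> bool" where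
  "piecewise_linear_curve C \<longleftrightarrow>
     (\<exists>n v. 1 \<le> (n::nat) \<and> C = (\<Union>i<n. closed_segment (v i) (v (Suc i))))"

definition decreasing_curve :: "(real \<times> real) set \<Rightarrow> bool" where
  "decreasing_curve C \<longleftrightarrow> (\<forall>(p, d) \<in> C. \<forall>(p', d') \<in> C. p < p' \<longrightarrow> d' < d)"

text \<open>The set of points on or above the curve (its epigraph) is convex.\<close>
definition convex_curve :: "(real \<times> real) set \<Rightarrow> bool" where
  "convex_curve C \<longleftrightarrow> convex {(p, d). \<exists>d'. (p, d') \<in> C \<and> d' \<le> d}"

end

theory Submission
  imports Defs
begin

text \<open>The region of power-delay pairs is the linear image of a polytope, hence a planar polytope, and
  the tradeoff curve is its set of weakly Pareto-optimal points. Such a set is a convex polygonal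
  chain; it is decreasing provided that the minimal delay is attained at a single power, since
  otherwise it would contain a horizontal segment. Here this holds: always \<open>q \<ge> a\<close>,
  and the minimal delay 1 forces \<open>q = a = s\<close>, so that the power is the mean of \<open>P\<close>
  under the unique stationary distribution of the arrivals.\<close>

section \<open>Images of polytopes given by nonnegativity and linear equations\<close>

text \<open>The two ends of the curve behave differently. At the minimal power a vertical segment
  may occur; strict decrease tolerates it, since only points of different power are compared. At the
  minimal delay a horizontal segment would violate strict decrease, and nothing in the geometry
  excludes it. This is where the arrival chain enters: the mean of \<open>q\<close> splits into the
  mean of \<open>a\<close>, which is \<alpha>, and the mean excess of \<open>q\<close> over
  \<open>a\<close>, so the delay is 1 plus the scaled excess. At zero excess the only freedom left
  is the law of the arrivals, and irreducibility fixes that law. For the polytope property, families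
  are handled as plain functions. Only three facts about them matter: nonnegativity, total mass 1,
  and closure under affine combinations that stay nonnegative.\<close>

lemma support_reducing_ray:
  fixes x y :: "'i \<Rightarrow> real"
  assumes fin: "finite I"
    and nonneg: "\<forall>i\<in>I. 0 \<le> x i" "\<forall>i\<in>I. 0 \<le> y i"
    and same_sum: "sum x I = sum y I"
    and supp: "\<forall>i\<in>I. x i = 0 \<longrightarrow> y i = 0"
    and differ: "\<exists>i\<in>I. x i \<noteq> y i"
  obtains t where "0 < t" "\<forall>i\<in>I. 0 \<le> (1 - (-t)) * x i + (-t) * y i"
    "{i\<in>I. (1 - (-t)) * x i + (-t) * y i \<noteq> 0} \<subset> {i\<in>I. x i \<noteq> 0}"
proof -
  \<comment> \<open>\<open>D\<close> holds the coordinates that shrink when \<open>x\<close> is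
    pushed away from \<open>y\<close>. Equal sums make it nonempty, and \<open>r i\<close> is the
    time at which coordinate \<open>i\<close> reaches 0; stopping at the earliest such time keeps
    every coordinate nonnegative and kills one. The parameter appears as \<open>-t\<close> so that
    the moved point has the shape \<open>(1 - t) * x i + t * y i\<close> of a general affine
    combination.\<close>
  define D where "D = {i\<in>I. x i < y i}"
  have "D \<noteq> {}"
  proof
    assume "D = {}"
    then have le: "\<forall>i\<in>I. y i \<le> x i" unfolding D_def by (auto simp: not_less)
    have "sum (\<lambda>i. x i - y i) I = 0" using same_sum by (simp add: sum_subtractf)
    then have "\<forall>i\<in>I. x i - y i = 0"
      using le fin by (subst (asm) sum_nonneg_eq_0_iff) auto
    then show False using differ by auto
  qed
  have finD: "finite D" unfolding D_def using fin by auto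
  define r where "r i = x i / (y i - x i)" for i
  define t where "t = Min (r ` D)"
  have "t \<in> r ` D" unfolding t_def using finD \<open>D \<noteq> {}\<close> by (intro Min_in) auto
  then obtain k where k: "k \<in> D" "t = r k" by blast
  have tle: "t \<le> r i" if "i \<in> D" for i unfolding t_def using finD that by auto
  have xpos: "0 < x i" if "i \<in> D" for i
  proof -
    have "i \<in> I" "x i \<noteq> 0" "0 \<le> x i" using that nonneg(1) supp by (auto simp: D_def)
    then show ?thesis by simp
  qed
  have "0 < t" using k xpos[OF k(1)] by (auto simp: r_def D_def)
  moreover have "0 \<le> (1 - (-t)) * x i + (-t) * y i" if "i \<in> I" for i
  proof (cases "i \<in> D")
    case True
    then have "t * (y i - x i) \<le> x i"
      using tle[OF True] by (simp add: r_def D_def pos_le_divide_eq)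
    then show ?thesis by (simp add: algebra_simps)
  next
    case False
    then have "0 \<le> t * (x i - y i)" using that \<open>0 < t\<close> by (auto simp: D_def)
    then show ?thesis using nonneg(1) that by (auto simp: algebra_simps add_nonneg_nonneg)
  qed
  moreover have "{i\<in>I. (1 - (-t)) * x i + (-t) * y i \<noteq> 0} \<subset> {i\<in>I. x i \<noteq> 0}"
  proof -
    have "t * (y k - x k) = x k" using k by (auto simp: r_def D_def)
    then have "(1 - (-t)) * x k + (-t) * y k = 0" by (simp add: algebra_simps)
    moreover have "k \<in> I" "x k \<noteq> 0" using k xpos[OF k(1)] by (auto simp: D_def)
    ultimately show ?thesis using supp by auto
  qed
  ultimately show ?thesis using that by blast
qed

text \<open>The generators are the images of the points of minimal support; such a point is determined
  by its support.\<close>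
lemma affine_section_image_polytope:
  fixes K :: "('i \<Rightarrow> real) set" and h :: "('i \<Rightarrow> real) \<Rightarrow> 'b::real_vector"
  assumes fin: "finite I"
    and nonneg: "\<And>x i. x \<in> K \<Longrightarrow> i \<in> I \<Longrightarrow> 0 \<le> x i"
    and total: "\<And>x. x \<in> K \<Longrightarrow> sum x I = 1"
    and aff: "\<And>x y t. x \<in> K \<Longrightarrow> y \<in> K \<Longrightarrow> (\<forall>i\<in>I. 0 \<le> (1 - t) * x i + t * y i)
        \<Longrightarrow> (\<lambda>i. (1 - t) * x i + t * y i) \<in> K"
    and h_aff: "\<And>x y t. x \<in> K \<Longrightarrow> y \<in> K
        \<Longrightarrow> h (\<lambda>i. (1 - t) * x i + t * y i) = (1 - t) *\<^sub>R h x + t *\<^sub>R h y"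
    and h_cong: "\<And>x y. x \<in> K \<Longrightarrow> y \<in> K \<Longrightarrow> (\<forall>i\<in>I. x i = y i) \<Longrightarrow> h x = h y"
  obtains F where "finite F" "h ` K = convex hull F"
proof -
  define supp where "supp x = {i\<in>I. x i \<noteq> 0}" for x :: "'i \<Rightarrow> real"
  define M where "M = {x\<in>K. \<forall>y\<in>K. supp y \<subseteq> supp x \<longrightarrow> (\<forall>i\<in>I. x i = y i)}"
  have "h ` M \<subseteq> (\<lambda>T. h (SOME x. x \<in> M \<and> supp x = T)) ` Pow I"
  proof
    fix w assume "w \<in> h ` M"
    then obtain x where x: "x \<in> M" "w = h x" by blast
    define z where "z = (SOME z. z \<in> M \<and> supp z = supp x)"
    have z: "z \<in> M \<and> supp z = supp x"
      unfolding z_def by (rule someI[where x = x]) (use x(1) in blast)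
    then have "h x = h z" using x(1) by (intro h_cong) (auto simp: M_def)
    moreover have "supp x \<in> Pow I" by (auto simp: supp_def)
    ultimately show "w \<in> (\<lambda>T. h (SOME x. x \<in> M \<and> supp x = T)) ` Pow I"
      unfolding x(2) z_def by blast
  qed
  then have finM: "finite (h ` M)" by (rule finite_subset) (use fin in simp)
  have ray: "\<exists>t>0. (\<lambda>i. (1 - (-t)) * x i + (-t) * y i) \<in> K
      \<and> supp (\<lambda>i. (1 - (-t)) * x i + (-t) * y i) \<subset> supp x"
    if K: "x \<in> K" "y \<in> K" and "supp y \<subseteq> supp x" and differ: "\<exists>i\<in>I. x i \<noteq> y i" for x y
  proof -
    have zero: "\<forall>i\<in>I. x i = 0 \<longrightarrow> y i = 0"
      using \<open>supp y \<subseteq> supp x\<close> by (auto simp: supp_def)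
    have sums: "sum x I = sum y I" using total K by simp
    have pos: "\<forall>i\<in>I. 0 \<le> x i" "\<forall>i\<in>I. 0 \<le> y i" using nonneg K by auto
    obtain t where t: "0 < t" "\<forall>i\<in>I. 0 \<le> (1 - (-t)) * x i + (-t) * y i"
      "{i\<in>I. (1 - (-t)) * x i + (-t) * y i \<noteq> 0} \<subset> {i\<in>I. x i \<noteq> 0}"
      by (rule support_reducing_ray[OF fin pos sums zero differ])
    show ?thesis
      unfolding supp_def by (intro exI[of _ t] conjI t(1) t(3) aff[OF K t(2)])
  qed
  have in_hull: "h x \<in> convex hull (h ` M)" if "x \<in> K" for x
    using that
  proof (induction "card (supp x)" arbitrary: x rule: less_induct)
    case less
    show ?case
    proof (cases "x \<in> M")
      case True
      then show ?thesis by (simp add: hull_inc)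
    next
      case False
      then obtain y where y: "y \<in> K" "supp y \<subseteq> supp x" "\<exists>i\<in>I. x i \<noteq> y i"
        using less.prems by (auto simp: M_def)
      have fs: "finite (supp x)" unfolding supp_def using fin by simp
      \<comment> \<open>The support of \<open>y\<close> may equal that of \<open>x\<close>, so
        \<open>y\<close> cannot serve in the induction. Moving away from \<open>y\<close> gives
        \<open>z\<close> of strictly smaller support, and moving away from \<open>z\<close> gives
        \<open>w\<close>, again of smaller support; \<open>x\<close> lies between \<open>z\<close>
        and \<open>w\<close>.\<close>
      obtain z where z: "z \<in> K" "supp z \<subset> supp x"
        using ray[OF less.prems y] by blast
      then have "\<exists>i\<in>I. x i \<noteq> z i" by (auto simp: supp_def)
      then obtain t w where t: "0 < t" and w: "w = (\<lambda>i. (1 - (-t)) * x i + (-t) * z i)"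
        "w \<in> K" "supp w \<subset> supp x"
        using ray[OF less.prems z(1) psubset_imp_subset[OF z(2)]] by blast
      have hz: "h z \<in> convex hull (h ` M)"
        using less.hyps[OF psubset_card_mono[OF fs z(2)] z(1)] .
      have hw: "h w \<in> convex hull (h ` M)"
        using less.hyps[OF psubset_card_mono[OF fs w(3)] w(2)] .
      have "h w = (1 - (-t)) *\<^sub>R h x + (-t) *\<^sub>R h z"
        unfolding w(1) using less.prems z(1) by (rule h_aff)
      then have "h w + t *\<^sub>R h z = (1 + t) *\<^sub>R h x" by (simp add: algebra_simps)
      then have "(1 / (1 + t)) *\<^sub>R (h w + t *\<^sub>R h z) = h x" using t by simp
      then have "h x = (1 / (1 + t)) *\<^sub>R h w + (t / (1 + t)) *\<^sub>R h z"
        by (simp add: scaleR_add_right)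
      moreover have "1 / (1 + t) + t / (1 + t) = 1" using t by (simp add: field_simps)
      ultimately show ?thesis
        using convexD[OF convex_convex_hull hw hz, of "1 / (1 + t)" "t / (1 + t)"] t by simp
    qed
  qed
  have "convex (h ` K)"
  proof (rule convexI)
    fix a b and u v :: real
    assume ab: "a \<in> h ` K" "b \<in> h ` K" and uv: "0 \<le> u" "0 \<le> v" "u + v = 1"
    obtain x y where xy: "x \<in> K" "y \<in> K" "a = h x" "b = h y" using ab by blast
    have "u = 1 - v" using uv by simp
    then have "u *\<^sub>R a + v *\<^sub>R b = h (\<lambda>i. (1 - v) * x i + v * y i)"
      using h_aff[OF xy(1,2), of v] xy by simp
    moreover have "(\<lambda>i. (1 - v) * x i + v * y i) \<in> K"
      using uv xy nonneg by (intro aff) auto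
    ultimately show "u *\<^sub>R a + v *\<^sub>R b \<in> h ` K" by blast
  qed
  then have "convex hull (h ` M) \<subseteq> h ` K" by (intro hull_minimal) (auto simp: M_def)
  then have "h ` K = convex hull (h ` M)" using in_hull by blast
  then show ?thesis using that finM by blast
qed

section \<open>Weakly Pareto-optimal points of a planar polytope\<close>

definition weakly_pareto :: "(real \<times> real) set \<Rightarrow> (real \<times> real) set" where
  "weakly_pareto R = {(p, d) \<in> R. \<forall>(p', d') \<in> R. p \<le> p' \<or> d \<le> d'}"

text \<open>The starting vertex is recorded so that a further segment can be attached in
  front.\<close>

definition polygonal_from :: "'a::real_vector \<Rightarrow> 'a set \<Rightarrow> bool" where
  "polygonal_from z C \<longleftrightarrow>
     (\<exists>n v. 1 \<le> (n::nat) \<and> v 0 = z \<and> C = (\<Union>i<n. closed_segment (v i) (v (Suc i))))"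

lemma polygonal_from_segment: "polygonal_from y (closed_segment y z)"
  unfolding polygonal_from_def
  by (rule exI[of _ 1], rule exI[of _ "case_nat y (\<lambda>_. z)"]) (simp add: lessThan_Suc)

lemma polygonal_from_prepend:
  assumes "polygonal_from z C"
  shows "polygonal_from y (closed_segment y z \<union> C)"
proof -
  obtain n v where v: "1 \<le> (n::nat)" "v 0 = z" "C = (\<Union>i<n. closed_segment (v i) (v (Suc i)))"
    using assms unfolding polygonal_from_def by blast
  have "closed_segment y z \<union> C
      = (\<Union>i<Suc n. closed_segment (case_nat y v i) (case_nat y v (Suc i)))"
    unfolding v(3) lessThan_Suc_eq_insert_0 using v(2) by auto
  then show ?thesis
    unfolding polygonal_from_def
    by (intro exI[of _ "Suc n"] exI[of _ "case_nat y v"]) simp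
qed

text \<open>Induction on the number of break points strictly inside the interval: cutting at the
  smallest one leaves a first piece without break points, which is a segment by \<open>gap\<close>,
  and a rest with fewer of them.\<close>

lemma polygonal_from_graph:
  fixes f :: "real \<Rightarrow> real"
  assumes fin: "finite X" and "a \<le> b"
    and gap: "\<And>x y. a \<le> x \<Longrightarrow> x \<le> y \<Longrightarrow> y \<le> b \<Longrightarrow> X \<inter> {x<..<y} = {}
      \<Longrightarrow> (\<lambda>p. (p, f p)) ` {x..y} = closed_segment (x, f x) (y, f y)"
  shows "polygonal_from (a, f a) ((\<lambda>p. (p, f p)) ` {a..b})"
  using assms(2,3)
proof (induction "card (X \<inter> {a<..<b})" arbitrary: a rule: less_induct)
  case less
  show ?case
  proof (cases "X \<inter> {a<..<b} = {}")
    case True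
    then show ?thesis
      using less.prems(2)[of a b] less.prems(1) polygonal_from_segment by simp
  next
    case False
    define m where "m = Min (X \<inter> {a<..<b})"
    have m: "m \<in> X \<inter> {a<..<b}" unfolding m_def using fin False by (intro Min_in) auto
    have min: "m \<le> x" if "x \<in> X \<inter> {a<..<b}" for x unfolding m_def using fin that by auto
    have "X \<inter> {a<..<m} = {}" using m min by fastforce
    then have first: "(\<lambda>p. (p, f p)) ` {a..m} = closed_segment (a, f a) (m, f m)"
      using m by (intro less.prems(2)) auto
    have "X \<inter> {m<..<b} \<subset> X \<inter> {a<..<b}" using m by auto
    then have "polygonal_from (m, f m) ((\<lambda>p. (p, f p)) ` {m..b})"
      using fin m by (intro less.hyps less.prems(2) psubset_card_mono) auto
    moreover have "{a..b} = {a..m} \<union> {m..b}" using m by auto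
    ultimately show ?thesis
      using polygonal_from_prepend[of "(m, f m)" _ "(a, f a)"] by (simp add: image_Un first)
  qed
qed

section \<open>Strict domination and interpolation in convex planar sets\<close>

lemma ex_small_step:
  fixes a b c :: real
  assumes "a < b"
  obtains t where "0 < t" "t < 1" "(1 - t) * a + t * c < b"
proof -
  \<comment> \<open>The denominator dominates \<open>\<bar>c - a\<bar>\<close>, which keeps the
    displacement \<open>s * (c - a)\<close> below \<open>b - a\<close>, and it dominates
    \<open>b - a\<close>, which keeps \<open>s\<close> below 1.\<close>
  define s where "s = (b - a) / (2 * (1 + \<bar>c - a\<bar> + (b - a)))"
  have pos: "0 < 1 + \<bar>c - a\<bar> + (b - a)" using assms by (simp add: add_pos_nonneg)
  then have s0: "0 < s" unfolding s_def using assms by (intro divide_pos_pos) auto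
  have eq: "s * (2 * (1 + \<bar>c - a\<bar> + (b - a))) = b - a" unfolding s_def using pos by simp
  have "s * (2 * (1 + \<bar>c - a\<bar> + (b - a))) = 2 * s + 2 * (s * \<bar>c - a\<bar>) + 2 * (s * (b - a))"
    by (simp add: algebra_simps)
  then have e: "2 * s + 2 * (s * \<bar>c - a\<bar>) + 2 * (s * (b - a)) = b - a" using eq by simp
  have nn: "0 \<le> s * \<bar>c - a\<bar>" "0 < s * (b - a)" using s0 assms by auto
  have "s * (c - a) \<le> s * \<bar>c - a\<bar>" using s0 by (intro mult_left_mono) auto
  then have "s * (c - a) < b - a" using e nn s0 by linarith
  then have "(1 - s) * a + s * c < b" by (simp add: algebra_simps)
  moreover have "s < 1"
  proof (rule ccontr)
    assume "\<not> s < 1"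
    then have "b - a \<le> s * (b - a)" using assms by (simp add: mult_le_cancel_right1)
    then show False using e nn s0 by linarith
  qed
  ultimately show ?thesis using that s0 by blast
qed

text \<open>One point is strictly better in one coordinate and no worse in the other, where the
  second point is strictly better. A small step from the first towards the second keeps the first
  gain and adds the second. The two disjuncts exchange the coordinates.\<close>

lemma convex_strict_dominator:
  fixes R :: "(real \<times> real) set"
  assumes "convex R" "(p1, d1) \<in> R" "(p2, d2) \<in> R"
    and "(p1 < p \<and> d1 \<le> d \<and> d2 < d) \<or> (p1 \<le> p \<and> d1 < d \<and> p2 < p)"
  shows "\<exists>(p', d') \<in> R. p' < p \<and> d' < d"
proof -
  have mem: "((1 - t) * p1 + t * p2, (1 - t) * d1 + t * d2) \<in> R" if "0 < t" "t < 1" for t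
    using convexD[OF assms(1-3), of "1 - t" t] that by simp
  have strict: "(1 - t) * u + t * w < c" if "0 < t" "t < 1" "u \<le> c" "w < c" for t u w c :: real
  proof -
    have "(1 - t) * u \<le> (1 - t) * c" "t * w < t * c" using that by (auto intro: mult_left_mono)
    then show ?thesis by (simp add: algebra_simps)
  qed
  from assms(4) show ?thesis
  proof
    assume *: "p1 < p \<and> d1 \<le> d \<and> d2 < d"
    then obtain t where "0 < t" "t < 1" "(1 - t) * p1 + t * p2 < p"
      using ex_small_step[of p1 p p2] by blast
    then show ?thesis using mem[of t] strict[of t d1 d d2] * by blast
  next
    assume *: "p1 \<le> p \<and> d1 < d \<and> p2 < p"
    then obtain t where "0 < t" "t < 1" "(1 - t) * d1 + t * d2 < d"
      using ex_small_step[of d1 d d2] by blast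
    then show ?thesis using mem[of t] strict[of t p1 p p2] * by blast
  qed
qed

lemma convex_interpolate:
  fixes R :: "(real \<times> real) set"
  assumes "convex R" "(p1, d1) \<in> R" "(p2, d2) \<in> R" "p1 < p2" "p1 \<le> p" "p \<le> p2"
  shows "(p, d1 + (d2 - d1) / (p2 - p1) * (p - p1)) \<in> R"
proof -
  define t where "t = (p - p1) / (p2 - p1)"
  have t: "0 \<le> t" "t \<le> 1" "t * (p2 - p1) = p - p1" using assms by (auto simp: t_def)
  have "(1 - t) *\<^sub>R (p1, d1) + t *\<^sub>R (p2, d2) \<in> R"
    using convexD[OF assms(1-3), of "1 - t" t] t by simp
  moreover have "(1 - t) * p1 + t * p2 = p" using t(3) by (simp add: algebra_simps)
  moreover have "(1 - t) * d1 + t * d2 = d1 + (d2 - d1) / (p2 - p1) * (p - p1)"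
    by (simp add: t_def algebra_simps diff_divide_distrib)
  ultimately show ?thesis by simp
qed

text \<open>\<open>f\<close> is the lower boundary of \<open>R\<close>, constrained only over
  abscissas that occur in \<open>R\<close>; \<open>p0\<close> is the leftmost abscissa. The last
  assumption on \<open>p1\<close> excludes a horizontal edge at the bottom.\<close>

locale planar_polytope =
  fixes F R :: "(real \<times> real) set" and f :: "real \<Rightarrow> real" and p0 p1 d1 :: real
  assumes finite_F: "finite F" and R_def: "R = convex hull F"
    and p0: "\<And>p d. (p, d) \<in> R \<Longrightarrow> p0 \<le> p" "\<exists>d. (p0, d) \<in> R"
    and p1: "(p1, d1) \<in> R" "\<And>p d. (p, d) \<in> R \<Longrightarrow> d1 \<le> d" "\<And>p. (p, d1) \<in> R \<Longrightarrow> p = p1"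
    and f: "\<And>p d. (p, d) \<in> R \<Longrightarrow> (p, f p) \<in> R \<and> f p \<le> d"
begin

lemma convex_R: "convex R" unfolding R_def by (rule convex_convex_hull)

lemma p0_le_p1: "p0 \<le> p1" using p0(1) p1(1) by blast

lemma f_mem: "(p, f p) \<in> R" if "p0 \<le> p" "p \<le> p1"
proof (cases "p0 = p1")
  case True
  then show ?thesis using f[OF p1(1)] that by simp
next
  case False
  then obtain d where "(p0, d) \<in> R" "p0 < p1" using p0(2) p0_le_p1 by auto
  then show ?thesis using convex_interpolate[OF convex_R _ p1(1), of p0 d p] that f by blast
qed

lemma convex_combination_f:
  assumes "(p, d) \<in> R" "(p', d') \<in> R" "0 \<le> u" "0 \<le> v" "u + v = 1"
  shows "f (u * p + v * p') \<le> u * d + v * d'"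
  using convexD[OF convex_R assms] f by auto

text \<open>A point dominating the lower boundary at \<open>p \<le> p1\<close> would, joined to the point
  \<open>(p1, d1)\<close> of least ordinate, yield a point of \<open>R\<close> below \<open>(p, f p)\<close>.\<close>
lemma weakly_pareto_iff:
  "(p, d) \<in> weakly_pareto R \<longleftrightarrow> (p, d) \<in> R \<and> p \<le> p1 \<and> (p = p0 \<or> d = f p)"
proof
  assume "(p, d) \<in> weakly_pareto R"
  then have R: "(p, d) \<in> R" and opt: "\<And>p' d'. (p', d') \<in> R \<Longrightarrow> p \<le> p' \<or> d \<le> d'"
    by (auto simp: weakly_pareto_def)
  have "p \<le> p1"
    using opt[OF p1(1)] p1(2)[OF R] p1(3)[of p] R by force
  \<comment> \<open>A point above the lower boundary is strictly dominated after a small step from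
    \<open>(p, f p)\<close> towards a leftmost point. Over \<open>p0\<close> no point lies further
    left, which is why the whole vertical fibre survives there.\<close>
  moreover have "d = f p" if "p \<noteq> p0"
  proof (rule ccontr)
    assume "d \<noteq> f p"
    then have fp: "(p, f p) \<in> R" "f p < d" using f[OF R] by auto
    obtain e where e: "(p0, e) \<in> R" using p0(2) by blast
    have "p0 < p" using p0(1)[OF R] that by simp
    then show False
      using convex_strict_dominator[OF convex_R fp(1) e, of p d] fp opt by force
  qed
  ultimately show "(p, d) \<in> R \<and> p \<le> p1 \<and> (p = p0 \<or> d = f p)" using R by blast
next
  assume *: "(p, d) \<in> R \<and> p \<le> p1 \<and> (p = p0 \<or> d = f p)"
  have "p \<le> p' \<or> d \<le> d'" if R': "(p', d') \<in> R" for p' d'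
  proof (rule ccontr)
    assume "\<not> (p \<le> p' \<or> d \<le> d')"
    then have lt: "p' < p" "d' < d" by auto
    then have d: "d = f p" using * p0(1)[OF R'] by auto
    define m where "m = (d1 - d') / (p1 - p')"
    have "m \<le> 0" using p1(2)[OF R'] lt * by (auto simp: m_def divide_le_0_iff)
    then have "m * (p - p') \<le> 0" using lt by (simp add: mult_nonpos_nonneg)
    moreover have "(p, d' + m * (p - p')) \<in> R"
      using convex_interpolate[OF convex_R R' p1(1), of p] lt * by (simp add: m_def)
    then have "d \<le> d' + m * (p - p')" unfolding d using f by blast
    ultimately show False using lt by simp
  qed
  then show "(p, d) \<in> weakly_pareto R" using * by (auto simp: weakly_pareto_def)
qed

text \<open>Weak optimality alone yields only \<open>d' \<le> d\<close>. In case of equality the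
  left point is not the lowest one, and a small step from it towards \<open>(p1, d1)\<close> would
  strictly dominate the right point.\<close>

lemma decreasing_curve_weakly_pareto: "decreasing_curve (weakly_pareto R)"
proof -
  have "d' < d" if "(p, d) \<in> weakly_pareto R" "(p', d') \<in> weakly_pareto R" "p < p'" for p d p' d'
  proof -
    have R: "(p, d) \<in> R" "(p', d') \<in> R" "p' \<le> p1" using that by (auto simp: weakly_pareto_iff)
    have opt: "p' \<le> p'' \<or> d' \<le> d''" if "(p'', d'') \<in> R" for p'' d''
      using \<open>(p', d') \<in> weakly_pareto R\<close> that by (auto simp: weakly_pareto_def)
    have "d' \<le> d" using opt[OF R(1)] that(3) by auto
    moreover have "d' \<noteq> d"
    proof
      assume eq: "d' = d"
      have "d \<noteq> d1" using p1(3)[of p] R that(3) by auto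
      then have "d1 < d" using p1(2)[OF R(1)] by simp
      then show False
        using convex_strict_dominator[OF convex_R R(1) p1(1), of p' d'] that(3) opt eq by force
    qed
    ultimately show ?thesis by simp
  qed
  then show ?thesis unfolding decreasing_curve_def by blast
qed

lemma convex_curve_weakly_pareto: "convex_curve (weakly_pareto R)"
proof -
  \<comment> \<open>The vertical segment over \<open>p0\<close> lies above
    \<open>(p0, f p0)\<close>, so it adds nothing to the epigraph.\<close>
  have epi: "(\<exists>d'. (p, d') \<in> weakly_pareto R \<and> d' \<le> d) \<longleftrightarrow> p0 \<le> p \<and> p \<le> p1 \<and> f p \<le> d" for p d
    using p0(1) f f_mem by (force simp: weakly_pareto_iff)
  have "convex {(p, d). p0 \<le> p \<and> p \<le> p1 \<and> f p \<le> d}"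
  proof (rule convexI, clarsimp)
    fix p d p' d' u v :: real
    assume a: "0 \<le> u" "0 \<le> v" "u + v = 1" "p0 \<le> p" "p \<le> p1" "f p \<le> d"
      "p0 \<le> p'" "p' \<le> p1" "f p' \<le> d'"
    have "f (u * p + v * p') \<le> u * f p + v * f p'"
      using a by (intro convex_combination_f f_mem)
    also have "\<dots> \<le> u * d + v * d'" using a by (intro add_mono mult_left_mono)
    finally have "f (u * p + v * p') \<le> u * d + v * d'" .
    moreover have "u * p + v * p' \<in> {p0..p1}"
      using convexD[OF convex_real_interval(5), of p p0 p1 p' u v] a by simp
    ultimately show "p0 \<le> u * p + v * p' \<and> u * p + v * p' \<le> p1 \<and> f (u * p + v * p') \<le> u * d + v * d'"
      by simp
  qed
  then show ?thesis unfolding convex_curve_def epi .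
qed

text \<open>Without generators whose abscissa lies strictly between \<open>a\<close> and \<open>b\<close>, each point of \<open>R\<close>
  over \<open>{a..b}\<close> lies on a segment of \<open>R\<close> that spans \<open>{a..b}\<close>, so it is not below the chord.\<close>
lemma chord_le_f:
  assumes ab: "p0 \<le> a" "a < b" "b \<le> p1" and gap: "fst ` F \<inter> {a<..<b} = {}"
    and t: "0 \<le> t" "t \<le> 1"
  shows "(1 - t) * f a + t * f b \<le> f ((1 - t) * a + t * b)"
proof -
  define p where "p = (1 - t) * a + t * b"
  have p: "p = a + t * (b - a)" by (simp add: p_def algebra_simps)
  have "t * (b - a) \<le> 1 * (b - a)" using t ab by (intro mult_right_mono) auto
  moreover have "0 \<le> t * (b - a)" using t ab by simp
  ultimately have pab: "a \<le> p" "p \<le> b" unfolding p by simp_all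
  define G where "G = {z\<in>F. fst z \<le> a}"
  define H where "H = {z\<in>F. b \<le> fst z}"
  have F: "F = G \<union> H" using gap by (fastforce simp: G_def H_def)
  have hG: "convex hull G \<subseteq> {..a} \<times> UNIV"
    by (intro hull_minimal convex_Times) (auto simp: G_def)
  have hH: "convex hull H \<subseteq> {b..} \<times> UNIV"
    by (intro hull_minimal convex_Times) (auto simp: H_def)
  \<comment> \<open>\<open>convex_hull_union_two\<close> asks for both parts to be nonempty. If one
    were empty, \<open>R\<close> would lie entirely in the half-plane of the other and miss the
    boundary point over \<open>a\<close> or \<open>b\<close>.\<close>
  have "G \<noteq> {}"
  proof
    assume "G = {}"
    then have "R = convex hull H" by (simp add: R_def F)
    then show False using f_mem[of a] ab hH by auto
  qed
  moreover have "H \<noteq> {}"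
  proof
    assume "H = {}"
    then have "R = convex hull G" by (simp add: R_def F)
    then show False using f_mem[of b] ab hG by auto
  qed
  moreover have "(p, f p) \<in> R" using pab ab by (intro f_mem) linarith+
  then have "(p, f p) \<in> convex hull (convex hull G \<union> convex hull H)"
    unfolding R_def F by (simp flip: hull_Un_left hull_Un_right)
  ultimately have "\<exists>u v x y. (p, f p) = u *\<^sub>R x + v *\<^sub>R y \<and> 0 \<le> u \<and> 0 \<le> v \<and> u + v = 1
      \<and> x \<in> convex hull G \<and> y \<in> convex hull H"
    by (simp add: convex_hull_union_two)
  then obtain u v x y where uv: "0 \<le> u" "0 \<le> v" "u + v = 1"
      and xy: "x \<in> convex hull G" "y \<in> convex hull H" "(p, f p) = u *\<^sub>R x + v *\<^sub>R y"
    by blast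
  obtain px dx py dy where xyeq: "x = (px, dx)" "y = (py, dy)" by fastforce
  have sub: "convex hull G \<subseteq> R" "convex hull H \<subseteq> R" unfolding R_def F by (auto intro!: hull_mono)
  have R: "(px, dx) \<in> R" "(py, dy) \<in> R" using xy sub xyeq by auto
  have ord: "px \<le> a" "b \<le> py" using xy hG hH xyeq by auto
  \<comment> \<open>\<open>l\<close> is the line through \<open>x\<close> and \<open>y\<close>. Over
    \<open>{a..b}\<close> it runs inside \<open>R\<close>, hence not below \<open>f\<close>, and it
    meets \<open>f\<close> at \<open>p\<close>; comparing its values at \<open>a\<close>,
    \<open>p\<close> and \<open>b\<close> gives the claim.\<close>
  define m where "m = (dy - dx) / (py - px)"
  define l where "l s = dx + m * (s - px)" for s
  have l: "f s \<le> l s" if "a \<le> s" "s \<le> b" for s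
  proof -
    have "(s, l s) \<in> R"
      unfolding l_def m_def using ord ab that by (intro convex_interpolate[OF convex_R R]) linarith+
    then show ?thesis using f by blast
  qed
  have v: "u = 1 - v" using uv by simp
  have ps: "p - px = v * (py - px)" "f p = dx + v * (dy - dx)"
    using xy(3) by (simp_all add: xyeq v algebra_simps)
  have "m * (py - px) = dy - dx" using ord ab by (simp add: m_def)
  moreover have "l p = dx + v * (m * (py - px))" by (simp add: l_def ps(1))
  ultimately have "l p = f p" by (simp add: ps(2))
  moreover have "l p = (1 - t) * l a + t * l b"
    by (simp add: l_def p_def algebra_simps)
  moreover have "(1 - t) * f a + t * f b \<le> (1 - t) * l a + t * l b"
    using t l[of a] l[of b] ab by (intro add_mono mult_left_mono) auto
  ultimately show ?thesis by (simp add: p_def)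
qed

lemma graph_gap:
  assumes ab: "p0 \<le> a" "a \<le> b" "b \<le> p1" and gap: "fst ` F \<inter> {a<..<b} = {}"
  shows "(\<lambda>p. (p, f p)) ` {a..b} = closed_segment (a, f a) (b, f b)"
proof (cases "a = b")
  case False
  then have lt: "a < b" using ab by simp
  have f_aff: "f ((1 - t) * a + t * b) = (1 - t) * f a + t * f b" if "0 \<le> t" "t \<le> 1" for t
    using chord_le_f[OF ab(1) lt ab(3) gap that]
      convex_combination_f[OF f_mem[of a] f_mem[of b], of "1 - t" t] that ab by force
  have "{a..b} = (\<lambda>t. (1 - t) * a + t * b) ` {0..1}"
    using closed_segment_eq_real_ivl1[OF ab(2)] unfolding closed_segment_image_interval by simp
  then have "(\<lambda>p. (p, f p)) ` {a..b}
      = (\<lambda>t. ((1 - t) * a + t * b, f ((1 - t) * a + t * b))) ` {0..1}"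
    by (simp add: image_image)
  also have "\<dots> = (\<lambda>t. (1 - t) *\<^sub>R (a, f a) + t *\<^sub>R (b, f b)) ` {0..1}"
    by (intro image_cong) (auto simp: f_aff)
  finally show ?thesis by (simp add: closed_segment_image_interval)
qed auto

text \<open>The chain starts at the top \<open>e\<close> of the fibre over \<open>p0\<close>, which
  exists by compactness, descends to \<open>(p0, f p0)\<close> and follows the graph of
  \<open>f\<close>, whose break points are abscissas of generators. The descent may be
  degenerate.\<close>

lemma piecewise_linear_curve_weakly_pareto: "piecewise_linear_curve (weakly_pareto R)"
proof -
  define V where "V = R \<inter> {p0} \<times> UNIV"
  have "compact V" unfolding V_def R_def
    using finite_F by (intro compact_Int_closed finite_imp_compact_convex_hull closed_Times) auto
  moreover have "V \<noteq> {}" using p0(2) by (auto simp: V_def)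
  ultimately obtain z where z: "z \<in> V" "\<forall>w\<in>V. snd w \<le> snd z"
    using continuous_attains_sup[of V snd] continuous_on_snd[OF continuous_on_id] by blast
  define e where "e = snd z"
  have e: "(p0, e) \<in> R" using z by (auto simp: V_def e_def)
  have emax: "d \<le> e" if "(p0, d) \<in> R" for d using z(2) that by (force simp: V_def e_def)
  have vert: "closed_segment (p0, e) (p0, f p0) = {p0} \<times> {f p0..e}"
  proof -
    have "closed_segment (p0, e) (p0, f p0) = Pair p0 ` closed_segment e (f p0)"
      unfolding closed_segment_image_interval image_image
      by (intro image_cong) (auto simp: algebra_simps)
    then show ?thesis
      using f[OF e] by (auto simp: closed_segment_eq_real_ivl)
  qed
  have "weakly_pareto R = closed_segment (p0, e) (p0, f p0) \<union> (\<lambda>p. (p, f p)) ` {p0..p1}"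
  proof (intro equalityI subsetI)
    fix w assume "w \<in> weakly_pareto R"
    then obtain p d where "w = (p, d)" "(p, d) \<in> R" "p \<le> p1" "p = p0 \<or> d = f p"
      by (cases w) (auto simp: weakly_pareto_iff)
    then show "w \<in> closed_segment (p0, e) (p0, f p0) \<union> (\<lambda>p. (p, f p)) ` {p0..p1}"
      using f emax p0(1) by (auto simp: vert)
  next
    fix w assume w: "w \<in> closed_segment (p0, e) (p0, f p0) \<union> (\<lambda>p. (p, f p)) ` {p0..p1}"
    have "closed_segment (p0, e) (p0, f p0) \<subseteq> R"
      using convex_R e f[OF e] by (intro closed_segment_subset) auto
    then show "w \<in> weakly_pareto R"
      using w f_mem p0_le_p1 by (auto simp: vert weakly_pareto_iff)
  qed
  moreover have "polygonal_from (p0, f p0) ((\<lambda>p. (p, f p)) ` {p0..p1})"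
    using finite_F p0_le_p1 by (intro polygonal_from_graph[of "fst ` F"] graph_gap) auto
  ultimately have "polygonal_from (p0, e) (weakly_pareto R)"
    using polygonal_from_prepend by metis
  then show ?thesis unfolding polygonal_from_def piecewise_linear_curve_def by blast
qed

end

lemma weakly_pareto_polytope:
  fixes F :: "(real \<times> real) set"
  assumes "finite F" and p1: "(p1, d1) \<in> convex hull F"
    and least: "\<And>p d. (p, d) \<in> convex hull F \<Longrightarrow> d1 \<le> d"
    and unique: "\<And>p. (p, d1) \<in> convex hull F \<Longrightarrow> p = p1"
  shows "piecewise_linear_curve (weakly_pareto (convex hull F))
    \<and> decreasing_curve (weakly_pareto (convex hull F))
    \<and> convex_curve (weakly_pareto (convex hull F))"
proof -
  let ?R = "convex hull F"
  have comp: "compact ?R" using assms(1) by (rule finite_imp_compact_convex_hull)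
  obtain z where z: "z \<in> ?R" "\<forall>w\<in>?R. fst z \<le> fst w"
    using continuous_attains_inf[OF comp, of fst] continuous_on_fst[OF continuous_on_id] p1 by blast
  have "\<exists>e. (p, e) \<in> ?R \<and> (\<forall>d. (p, d) \<in> ?R \<longrightarrow> e \<le> d)" if "(p, d) \<in> ?R" for p d
  proof -
    have "compact (?R \<inter> {p} \<times> UNIV)"
      using comp by (intro compact_Int_closed closed_Times) auto
    moreover have "?R \<inter> {p} \<times> UNIV \<noteq> {}" using that by auto
    ultimately obtain w where "w \<in> ?R \<inter> {p} \<times> UNIV" "\<forall>v\<in>?R \<inter> {p} \<times> UNIV. snd w \<le> snd v"
      using continuous_attains_inf[of "?R \<inter> {p} \<times> UNIV" snd]
        continuous_on_snd[OF continuous_on_id] by blast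
    then show ?thesis by (intro exI[of _ "snd w"]) force
  qed
  then obtain f where f: "\<And>p d. (p, d) \<in> ?R \<Longrightarrow> (p, f p) \<in> ?R \<and> (\<forall>d. (p, d) \<in> ?R \<longrightarrow> f p \<le> d)"
    by metis
  interpret planar_polytope F ?R f "fst z" p1 d1
  proof
    show "fst z \<le> p" if "(p, d) \<in> ?R" for p d using z(2) that by force
    show "\<exists>d. (fst z, d) \<in> ?R" using z(1) by (intro exI[of _ "snd z"]) simp
  qed (use assms f in blast)+
  show ?thesis
    using piecewise_linear_curve_weakly_pareto decreasing_curve_weakly_pareto
      convex_curve_weakly_pareto by blast
qed

section \<open>Stationary vectors of an irreducible chain\<close>

text \<open>Zeros spread backwards along edges: a vanishing entry is a sum of nonnegative inflows,
  so every predecessor vanishes too, and \<open>b\<close> can be reached from every state.\<close>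

lemma stationary_vector_zero:
  assumes erg: "ergodic_chain A \<gamma>"
    and nonneg: "\<And>a. a \<le> A \<Longrightarrow> 0 \<le> v a"
    and stat: "\<And>a'. a' \<le> A \<Longrightarrow> (\<Sum>a\<le>A. v a * \<gamma> a a') = v a'"
    and b: "b \<le> A" "v b = 0" and "a \<le> A"
  shows "v a = 0"
proof -
  let ?E = "{(i, j). i \<le> A \<and> j \<le> A \<and> 0 < \<gamma> i j}"
  have \<gamma>: "0 \<le> \<gamma> i j" if "i \<le> A" "j \<le> A" for i j
    using erg that by (auto simp: ergodic_chain_def stochastic_def)
  have "(a, b) \<in> ?E\<^sup>*" using erg b(1) \<open>a \<le> A\<close> by (auto simp: ergodic_chain_def)
  then show ?thesis
  proof (induction rule: converse_rtrancl_induct)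
    case base
    show ?case by (rule b(2))
  next
    case (step i j)
    then have ij: "i \<le> A" "j \<le> A" "0 < \<gamma> i j" by auto
    have "(\<Sum>a\<le>A. v a * \<gamma> a j) = 0" using stat[OF ij(2)] step.IH by simp
    then have "v i * \<gamma> i j = 0"
      using ij nonneg \<gamma> by (subst (asm) sum_nonneg_eq_0_iff) auto
    then show ?case using ij by simp
  qed
qed

lemma stationary_distribution_pos:
  assumes erg: "ergodic_chain A \<gamma>" and \<phi>: "stationary_distribution A \<gamma> \<phi>" and "b \<le> A"
  shows "0 < \<phi> b"
proof (rule ccontr)
  assume "\<not> 0 < \<phi> b"
  then have "\<phi> b = 0" using \<phi> \<open>b \<le> A\<close> by (force simp: stationary_distribution_def)
  then have "\<phi> a = 0" if "a \<le> A" for a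
    using stationary_vector_zero[OF erg, of \<phi> b a] \<phi> \<open>b \<le> A\<close> that
    by (auto simp: stationary_distribution_def)
  then have "(\<Sum>a\<le>A. \<phi> a) = 0" by simp
  then show False using \<phi> by (simp add: stationary_distribution_def)
qed

text \<open>Subtracting from \<open>\<pi>\<close> the largest multiple of \<open>\<phi>\<close> that keeps it nonnegative
  leaves a stationary vector with a zero.\<close>
lemma stationary_distribution_unique:
  assumes erg: "ergodic_chain A \<gamma>"
    and \<phi>: "stationary_distribution A \<gamma> \<phi>" and \<pi>: "stationary_distribution A \<gamma> \<pi>"
    and "a \<le> A"
  shows "\<pi> a = \<phi> a"
proof -
  have pos: "0 < \<phi> i" if "i \<le> A" for i
    using stationary_distribution_pos[OF erg \<phi> that] .
  define c where "c = Min ((\<lambda>i. \<pi> i / \<phi> i) ` {..A})"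
  have "c \<in> (\<lambda>i. \<pi> i / \<phi> i) ` {..A}" unfolding c_def by (intro Min_in) auto
  then obtain b where b: "b \<le> A" "c = \<pi> b / \<phi> b" by auto
  have c: "c * \<phi> i \<le> \<pi> i" if "i \<le> A" for i
  proof -
    have "c \<le> \<pi> i / \<phi> i" unfolding c_def using that by auto
    then show ?thesis using pos[OF that] by (simp add: pos_le_divide_eq)
  qed
  have eq: "\<pi> i = c * \<phi> i" if "i \<le> A" for i
  proof -
    have "\<pi> i - c * \<phi> i = 0"
    proof (rule stationary_vector_zero[OF erg, where b = b])
      show "(\<Sum>a\<le>A. (\<pi> a - c * \<phi> a) * \<gamma> a a') = \<pi> a' - c * \<phi> a'" if "a' \<le> A" for a'
      proof -
        have "(\<Sum>a\<le>A. (\<pi> a - c * \<phi> a) * \<gamma> a a')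
            = (\<Sum>a\<le>A. \<pi> a * \<gamma> a a') - c * (\<Sum>a\<le>A. \<phi> a * \<gamma> a a')"
          by (simp add: sum_subtractf sum_distrib_left algebra_simps)
        then show ?thesis using \<phi> \<pi> that by (simp add: stationary_distribution_def)
      qed
    qed (use b c that pos[of b] in auto)
    then show ?thesis by simp
  qed
  have "(\<Sum>i\<le>A. \<pi> i) = c * (\<Sum>i\<le>A. \<phi> i)" by (simp add: eq sum_distrib_left)
  then have "c = 1" using \<phi> \<pi> by (simp add: stationary_distribution_def)
  then show ?thesis using eq \<open>a \<le> A\<close> by simp
qed

section \<open>State-action frequencies\<close>

text \<open>The indicator already confines \<open>q\<close> to the original range, where
  \<open>a' \<le> A \<le> S\<close> makes \<open>q' + S - a'\<close> an exact difference. With the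
  fixed range \<open>{..Q}\<close> the sums can be interchanged.\<close>

lemma frequencies_iff:
  assumes "A \<le> S"
  shows "x \<in> frequencies A S Q \<gamma> \<longleftrightarrow>
     (\<forall>q\<le>Q. \<forall>a\<le>A. \<forall>s\<le>S. 0 \<le> x q a s) \<and>
     (\<forall>q\<le>Q. \<forall>a\<le>A. \<forall>s\<le>S. s \<notin> feasible_rates A S Q q \<longrightarrow> x q a s = 0) \<and>
     (\<Sum>q\<le>Q. \<Sum>a\<le>A. \<Sum>s\<le>S. x q a s) = 1 \<and>
     (\<forall>q'\<le>Q. \<forall>a'\<le>A.
        (\<Sum>q\<le>Q. \<Sum>a\<le>A. \<Sum>s\<le>S. \<gamma> a a' * x q a s * of_bool (s + q' = q + a'))
        = (\<Sum>s\<le>S. x q' a' s))"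
proof -
  have "(\<Sum>q = q' - a'..min (q' + S - a') Q. \<Sum>a\<le>A. \<Sum>s\<le>S.
            \<gamma> a a' * x q a s * of_bool (s + q' = q + a'))
      = (\<Sum>q\<le>Q. \<Sum>a\<le>A. \<Sum>s\<le>S. \<gamma> a a' * x q a s * of_bool (s + q' = q + a'))"
    if "a' \<le> A" for q' a'
    using that assms by (intro sum.mono_neutral_left) (auto intro!: sum.neutral)
  then show ?thesis by (simp add: frequencies_def)
qed

lemma triple_sum_nonneg_eq_0:
  fixes g :: "nat \<Rightarrow> nat \<Rightarrow> nat \<Rightarrow> real"
  assumes zero: "(\<Sum>q\<le>Q. \<Sum>a\<le>A. \<Sum>s\<le>S. g q a s) = 0"
    and nonneg: "\<And>q a s. q \<le> Q \<Longrightarrow> a \<le> A \<Longrightarrow> s \<le> S \<Longrightarrow> 0 \<le> g q a s"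
    and le: "q \<le> Q" "a \<le> A" "s \<le> S"
  shows "g q a s = 0"
proof -
  have "(\<Sum>(q, a, s)\<in>{..Q} \<times> {..A} \<times> {..S}. g q a s) = 0"
    using zero by (simp only: sum.cartesian_product)
  then have "\<forall>(q, a, s)\<in>{..Q} \<times> {..A} \<times> {..S}. g q a s = 0"
    using nonneg by (subst (asm) sum_nonneg_eq_0_iff) auto
  then show ?thesis using le by auto
qed

text \<open>The balance equations in weak form: a test function of queue and arrivals has the same
  mean before and after one step. All later facts come from choosing \<open>f\<close>.\<close>

lemma frequencies_balance:
  fixes f :: "nat \<Rightarrow> nat \<Rightarrow> real"
  assumes "A \<le> S" "A \<le> Q" and x: "x \<in> frequencies A S Q \<gamma>"
  shows "(\<Sum>q\<le>Q. \<Sum>a\<le>A. \<Sum>s\<le>S. f q a * x q a s)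
    = (\<Sum>q\<le>Q. \<Sum>a\<le>A. \<Sum>s\<le>S. (\<Sum>a'\<le>A. \<gamma> a a' * f (q + a' - s) a') * x q a s)"
proof -
  let ?I = "{..Q} \<times> {..A} \<times> {..S}"
  have triple: "(\<Sum>q\<le>Q. \<Sum>a\<le>A. \<Sum>s\<le>S. g q a s) = (\<Sum>(q, a, s)\<in>?I. g q a s)"
    for g :: "nat \<Rightarrow> nat \<Rightarrow> nat \<Rightarrow> real"
    by (simp only: sum.cartesian_product)
  have "(\<Sum>q'\<le>Q. \<Sum>a'\<le>A. \<Sum>s\<le>S. f q' a' * x q' a' s)
      = (\<Sum>q'\<le>Q. \<Sum>a'\<le>A. f q' a' * (\<Sum>q\<le>Q. \<Sum>a\<le>A. \<Sum>s\<le>S.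
            \<gamma> a a' * x q a s * of_bool (s + q' = q + a')))"
    using x assms(1) by (simp add: frequencies_iff flip: sum_distrib_left)
  also have "\<dots> = (\<Sum>q'\<le>Q. \<Sum>a'\<le>A. \<Sum>q\<le>Q. \<Sum>a\<le>A. \<Sum>s\<le>S.
            f q' a' * (\<gamma> a a' * x q a s * of_bool (s + q' = q + a')))"
    by (simp only: sum_distrib_left)
  also have "\<dots> = (\<Sum>(q, a, s)\<in>?I. \<Sum>q'\<le>Q. \<Sum>a'\<le>A.
            f q' a' * (\<gamma> a a' * x q a s * of_bool (s + q' = q + a')))"
    by (simp only: triple sum.swap[where B = ?I] case_prod_unfold)
  also have "\<dots> = (\<Sum>(q, a, s)\<in>?I. (\<Sum>a'\<le>A. \<gamma> a a' * f (q + a' - s) a') * x q a s)"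
  proof (intro sum.cong refl, clarsimp)
    fix q a s assume le: "q \<le> Q" "a \<le> A" "s \<le> S"
    show "(\<Sum>q'\<le>Q. \<Sum>a'\<le>A. f q' a' * (\<gamma> a a' * x q a s * of_bool (s + q' = q + a')))
        = (\<Sum>a'\<le>A. \<gamma> a a' * f (q + a' - s) a') * x q a s"
    proof (cases "x q a s = 0")
      case False
      then have "s \<in> feasible_rates A S Q q"
        using x le assms(1) unfolding frequencies_iff[OF assms(1)] by blast
      \<comment> \<open>The lower bound on the rate puts the next queue length
        \<open>q + a' - s\<close> inside \<open>{..Q}\<close>, so the sum over \<open>q'\<close>
        does hit it; the upper bound makes the subtraction exact.\<close>
      then have s: "s \<le> q" "q + A \<le> Q + s" by (auto simp: feasible_rates_def)
      have "(\<Sum>q'\<le>Q. \<Sum>a'\<le>A. f q' a' * (\<gamma> a a' * x q a s * of_bool (s + q' = q + a')))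
          = (\<Sum>a'\<le>A. \<Sum>q'\<le>Q. if q' = q + a' - s then f q' a' * (\<gamma> a a' * x q a s) else 0)"
        using s by (subst sum.swap) (intro sum.cong, auto)
      also have "\<dots> = (\<Sum>a'\<le>A. f (q + a' - s) a' * (\<gamma> a a' * x q a s))"
        using s by (intro sum.cong refl) (subst sum.delta, auto)
      finally show ?thesis by (simp add: sum_distrib_left sum_distrib_right mult_ac)
    qed simp
  qed
  finally show ?thesis by (simp only: triple)
qed

text \<open>Test functions of the arrivals alone show that the arrival marginal is stationary for
  \<gamma>; uniqueness then identifies it.\<close>

lemma frequencies_marginal:
  assumes "A \<le> S" "A \<le> Q" and erg: "ergodic_chain A \<gamma>"
    and \<phi>: "stationary_distribution A \<gamma> \<phi>" and x: "x \<in> frequencies A S Q \<gamma>" and "b \<le> A"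
  shows "(\<Sum>q\<le>Q. \<Sum>s\<le>S. x q b s) = \<phi> b"
proof -
  define \<pi> where "\<pi> a = (\<Sum>q\<le>Q. \<Sum>s\<le>S. x q a s)" for a
  have weighted: "(\<Sum>q\<le>Q. \<Sum>a\<le>A. \<Sum>s\<le>S. g a * x q a s) = (\<Sum>a\<le>A. \<pi> a * g a)" for g
    unfolding \<pi>_def by (subst sum.swap) (simp add: sum_distrib_left sum_distrib_right mult.commute)
  have "stationary_distribution A \<gamma> \<pi>"
    unfolding stationary_distribution_def
  proof (intro conjI allI impI)
    show "0 \<le> \<pi> a" if "a \<le> A" for a
      unfolding \<pi>_def using x that assms(1) by (intro sum_nonneg) (simp add: frequencies_iff)
    show "(\<Sum>a\<le>A. \<pi> a) = 1"
      using weighted[of "\<lambda>_. 1"] x assms(1) by (simp add: frequencies_iff)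
    show "(\<Sum>a\<le>A. \<pi> a * \<gamma> a a') = \<pi> a'" if "a' \<le> A" for a'
    proof -
      have pick: "(\<Sum>a\<le>A. g a * of_bool (a = a')) = g a'" for g :: "nat \<Rightarrow> real"
        using that by (simp add: of_bool_def if_distrib[of "(*) _"] cong: if_cong)
      have "(\<Sum>a\<le>A. \<pi> a * \<gamma> a a') = (\<Sum>a\<le>A. \<pi> a * of_bool (a = a'))"
        using frequencies_balance[OF assms(1,2) x, of "\<lambda>q a. of_bool (a = a')"]
        by (simp only: weighted pick)
      then show ?thesis by (simp only: pick)
    qed
  qed
  then show ?thesis
    using stationary_distribution_unique[OF erg \<phi>] \<open>b \<le> A\<close> unfolding \<pi>_def by blast
qed

lemma frequencies_sum_arrivals:
  assumes "A \<le> S" "A \<le> Q" "ergodic_chain A \<gamma>" "stationary_distribution A \<gamma> \<phi>"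
    and "x \<in> frequencies A S Q \<gamma>"
  shows "(\<Sum>q\<le>Q. \<Sum>a\<le>A. \<Sum>s\<le>S. g a * x q a s) = (\<Sum>a\<le>A. g a * \<phi> a)"
  by (subst sum.swap) (simp add: frequencies_marginal[OF assms] flip: sum_distrib_left)

text \<open>After a step the queue is the nonnegative remainder \<open>q - s\<close> plus the new
  arrivals. Hence the indicator of \<open>q < a\<close>, used as test function, has mean 0.\<close>

lemma frequencies_queue_ge_arrivals:
  assumes "A \<le> S" "A \<le> Q" and x: "x \<in> frequencies A S Q \<gamma>"
    and le: "q \<le> Q" "a \<le> A" "s \<le> S" and "q < a"
  shows "x q a s = 0"
proof -
  have nonneg: "0 \<le> x q a s" if "q \<le> Q" "a \<le> A" "s \<le> S" for q a s
    using x that assms(1) by (simp add: frequencies_iff)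
  have "(\<Sum>q\<le>Q. \<Sum>a\<le>A. \<Sum>s\<le>S. of_bool (q < a) * x q a s)
      = (\<Sum>q\<le>Q. \<Sum>a\<le>A. \<Sum>s\<le>S. (\<Sum>a'\<le>A. \<gamma> a a' * of_bool (q + a' - s < a')) * x q a s)"
    by (rule frequencies_balance[OF assms(1-3)])
  also have "\<dots> = 0"
  proof (intro sum.neutral ballI)
    fix q a s assume le: "q \<in> {..Q}" "a \<in> {..A}" "s \<in> {..S}"
    show "(\<Sum>a'\<le>A. \<gamma> a a' * of_bool (q + a' - s < a')) * x q a s = 0"
    proof (cases "x q a s = 0")
      case False
      then have "s \<in> feasible_rates A S Q q"
        using x le unfolding frequencies_iff[OF assms(1)] by blast
      then have "\<not> q + a' - s < a'" for a' by (auto simp: feasible_rates_def)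
      then show ?thesis by simp
    qed simp
  qed
  finally have "of_bool (q < a) * x q a s = 0"
  proof (rule triple_sum_nonneg_eq_0)
    show "0 \<le> of_bool (q < a) * x q a s" if "q \<le> Q" "a \<le> A" "s \<le> S" for q a s
      using nonneg[OF that] by simp
  qed (rule le)+
  then show ?thesis using \<open>q < a\<close> by simp
qed

lemma frequencies_mean_queue:
  assumes "A \<le> S" "A \<le> Q" and erg: "ergodic_chain A \<gamma>"
    and \<phi>: "stationary_distribution A \<gamma> \<phi>" and x: "x \<in> frequencies A S Q \<gamma>"
  shows "(\<Sum>q\<le>Q. \<Sum>a\<le>A. \<Sum>s\<le>S. real q * x q a s)
    = mean_arrivals A \<phi> + (\<Sum>q\<le>Q. \<Sum>a\<le>A. \<Sum>s\<le>S. (real q - real a) * x q a s)"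
proof -
  have "(\<Sum>q\<le>Q. \<Sum>a\<le>A. \<Sum>s\<le>S. real q * x q a s)
      = (\<Sum>q\<le>Q. \<Sum>a\<le>A. \<Sum>s\<le>S. real a * x q a s + (real q - real a) * x q a s)"
    by (simp add: algebra_simps)
  then show ?thesis
    using frequencies_sum_arrivals[OF assms, of real] by (simp add: sum.distrib mean_arrivals_def)
qed

lemma frequencies_excess_nonneg:
  assumes "A \<le> S" "A \<le> Q" and x: "x \<in> frequencies A S Q \<gamma>"
    and "q \<le> Q" "a \<le> A" "s \<le> S"
  shows "0 \<le> (real q - real a) * x q a s"
  using frequencies_queue_ge_arrivals[OF assms] assms(4-6) x
  by (cases "q < a") (auto simp: frequencies_iff[OF assms(1)])

text \<open>If the queue never exceeds the latest arrivals, then every slot empties it: testing the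
  balance equations with \<open>q - a\<close> gives \<open>E (q - a) = E (q - s)\<close>.\<close>
lemma frequencies_minimal_queue:
  assumes "A \<le> S" "A \<le> Q" and erg: "ergodic_chain A \<gamma>"
    and \<phi>: "stationary_distribution A \<gamma> \<phi>" and x: "x \<in> frequencies A S Q \<gamma>"
    and min: "(\<Sum>q\<le>Q. \<Sum>a\<le>A. \<Sum>s\<le>S. (real q - real a) * x q a s) = 0"
    and le: "q \<le> Q" "a \<le> A" "s \<le> S" and "x q a s \<noteq> 0"
  shows "q = a \<and> s = a"
proof -
  have feas: "s \<le> q" if "q \<le> Q" "a \<le> A" "s \<le> S" "x q a s \<noteq> 0" for q a s
  proof -
    have "s \<in> feasible_rates A S Q q" using x that unfolding frequencies_iff[OF assms(1)] by blast
    then show ?thesis by (simp add: feasible_rates_def)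
  qed
  have nonneg: "0 \<le> x q a s" if "q \<le> Q" "a \<le> A" "s \<le> S" for q a s
    using x that assms(1) by (simp add: frequencies_iff)
  have stoch: "(\<Sum>a'\<le>A. \<gamma> a a') = 1" if "a \<le> A" for a
    using erg that by (simp add: ergodic_chain_def stochastic_def)
  \<comment> \<open>The excess of the next queue over the next arrivals is \<open>q - s\<close>
    whatever \<open>a'\<close> is, so averaging over \<open>a'\<close> leaves it unchanged.\<close>
  have "(\<Sum>q\<le>Q. \<Sum>a\<le>A. \<Sum>s\<le>S. (real q - real s) * x q a s)
      = (\<Sum>q\<le>Q. \<Sum>a\<le>A. \<Sum>s\<le>S. (\<Sum>a'\<le>A. \<gamma> a a' * (real (q + a' - s) - real a')) * x q a s)"
  proof (intro sum.cong refl)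
    fix q a s assume m: "q \<in> {..Q}" "a \<in> {..A}" "s \<in> {..S}"
    show "(real q - real s) * x q a s
        = (\<Sum>a'\<le>A. \<gamma> a a' * (real (q + a' - s) - real a')) * x q a s"
    proof (cases "x q a s = 0")
      case False
      then have "s \<le> q" using m by (intro feas[of q a s]) auto
      then have "real (q + a' - s) - real a' = real q - real s" for a' by (simp add: of_nat_diff)
      then have "(\<Sum>a'\<le>A. \<gamma> a a' * (real (q + a' - s) - real a'))
          = (\<Sum>a'\<le>A. \<gamma> a a') * (real q - real s)"
        by (simp only: sum_distrib_right)
      moreover have "(\<Sum>a'\<le>A. \<gamma> a a') = 1" using stoch m by simp
      ultimately show ?thesis by simp
    qed simp
  qed
  also have "\<dots> = 0"
    using frequencies_balance[OF assms(1,2) x, of "\<lambda>q a. real q - real a"]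
    unfolding min by (rule sym)
  finally have "(real q - real s) * x q a s = 0"
  proof (rule triple_sum_nonneg_eq_0)
    show "0 \<le> (real q - real s) * x q a s" if "q \<le> Q" "a \<le> A" "s \<le> S" for q a s
      using nonneg[OF that] feas[OF that] by (cases "x q a s = 0") auto
  qed (rule le)+
  moreover have "(real q - real a) * x q a s = 0"
    using min frequencies_excess_nonneg[OF assms(1,2) x] le by (rule triple_sum_nonneg_eq_0)
  ultimately show ?thesis using \<open>x q a s \<noteq> 0\<close> by simp
qed

section \<open>The minimal delay: its value, its power, its attainment\<close>

lemma mean_arrivals_pos:
  assumes "0 < A" "ergodic_chain A \<gamma>" "stationary_distribution A \<gamma> \<phi>"
  shows "0 < mean_arrivals A \<phi>"
proof -
  have "0 < \<phi> a" if "a \<le> A" for a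
    using stationary_distribution_pos[OF assms(2,3) that] .
  then have "0 < real A * \<phi> A" and "\<And>a. a \<le> A \<Longrightarrow> 0 \<le> real a * \<phi> a"
    using assms(1) by (simp_all add: less_imp_le)
  then show ?thesis unfolding mean_arrivals_def by (intro sum_pos2[of _ A]) auto
qed

lemma avg_delay_ge_1:
  assumes "0 < A" "A \<le> S" "A \<le> Q" "ergodic_chain A \<gamma>" "stationary_distribution A \<gamma> \<phi>"
    and "x \<in> frequencies A S Q \<gamma>"
  shows "1 \<le> avg_delay A S Q (mean_arrivals A \<phi>) x"
proof -
  have "0 \<le> (\<Sum>q\<le>Q. \<Sum>a\<le>A. \<Sum>s\<le>S. (real q - real a) * x q a s)"
    using frequencies_excess_nonneg[OF assms(2,3,6)] by (intro sum_nonneg) simp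
  then show ?thesis
    using mean_arrivals_pos[OF assms(1,4,5)] frequencies_mean_queue[OF assms(2-6)]
    by (simp add: avg_delay_def field_simps)
qed

text \<open>The right-hand side does not depend on \<open>x\<close>, which is the uniqueness that
  rules out a horizontal edge.\<close>

lemma avg_power_of_minimal_delay:
  assumes "0 < A" "A \<le> S" "A \<le> Q" "ergodic_chain A \<gamma>" "stationary_distribution A \<gamma> \<phi>"
    and x: "x \<in> frequencies A S Q \<gamma>" and "avg_delay A S Q (mean_arrivals A \<phi>) x = 1"
  shows "avg_power A S Q P x = (\<Sum>a\<le>A. P a * \<phi> a)"
proof -
  have min: "(\<Sum>q\<le>Q. \<Sum>a\<le>A. \<Sum>s\<le>S. (real q - real a) * x q a s) = 0"
    using mean_arrivals_pos[OF assms(1,4,5)] frequencies_mean_queue[OF assms(2-6)] assms(7)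
    by (simp add: avg_delay_def field_simps)
  have "avg_power A S Q P x = (\<Sum>q\<le>Q. \<Sum>a\<le>A. \<Sum>s\<le>S. P a * x q a s)"
    unfolding avg_power_def
    using frequencies_minimal_queue[OF assms(2-6) min] by (intro sum.cong refl) force
  then show ?thesis using frequencies_sum_arrivals[OF assms(2-6)] by simp
qed

text \<open>The policy that empties the queue in every slot.\<close>
lemma minimal_delay_attained:
  assumes "0 < A" "A \<le> S" "A \<le> Q" and erg: "ergodic_chain A \<gamma>"
    and \<phi>: "stationary_distribution A \<gamma> \<phi>"
  obtains x where "x \<in> frequencies A S Q \<gamma>" "avg_delay A S Q (mean_arrivals A \<phi>) x = 1"
proof -
  \<comment> \<open>The nested conditionals let the sum over \<open>s\<close> collapse first and the
    sum over \<open>q\<close> afterwards.\<close>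
  define x where "x q a s = (if s = a then if q = a then \<phi> a else 0 else 0)" for q a s :: nat
  have sum_x: "(\<Sum>q\<le>Q. \<Sum>a\<le>A. \<Sum>s\<le>S. g q a s * x q a s) = (\<Sum>a\<le>A. g a a a * \<phi> a)"
    for g :: "nat \<Rightarrow> nat \<Rightarrow> nat \<Rightarrow> real"
  proof -
    have "(\<Sum>q\<le>Q. \<Sum>s\<le>S. g q a s * x q a s) = g a a a * \<phi> a" if "a \<le> A" for a
    proof -
      have "(\<Sum>s\<le>S. g q a s * x q a s) = (if q = a then g a a a * \<phi> a else 0)" for q
        using that assms(2) by (simp add: x_def if_distrib[of "(*) _"] cong: if_cong)
      then show ?thesis using that assms(3) by simp
    qed
    then show ?thesis by (subst sum.swap) simp
  qed
  have "x \<in> frequencies A S Q \<gamma>"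
    unfolding frequencies_iff[OF assms(2)]
  proof (intro conjI allI impI)
    show "0 \<le> x q a s" if "a \<le> A" for q a s
      using \<phi> that by (simp add: x_def stationary_distribution_def)
    show "x q a s = 0" if "a \<le> A" "s \<le> S" "s \<notin> feasible_rates A S Q q" for q a s
      using that assms(3) by (auto simp: x_def feasible_rates_def)
    show "(\<Sum>q\<le>Q. \<Sum>a\<le>A. \<Sum>s\<le>S. x q a s) = 1"
      using sum_x[of "\<lambda>_ _ _. 1"] \<phi> by (simp add: stationary_distribution_def)
    show "(\<Sum>q\<le>Q. \<Sum>a\<le>A. \<Sum>s\<le>S. \<gamma> a a' * x q a s * of_bool (s + q' = q + a'))
        = (\<Sum>s\<le>S. x q' a' s)" if "q' \<le> Q" "a' \<le> A" for q' a'
    proof -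
      have "(\<Sum>q\<le>Q. \<Sum>a\<le>A. \<Sum>s\<le>S. \<gamma> a a' * x q a s * of_bool (s + q' = q + a'))
          = (\<Sum>a\<le>A. \<gamma> a a' * of_bool (q' = a') * \<phi> a)"
        using sum_x[of "\<lambda>q a s. \<gamma> a a' * of_bool (s + q' = q + a')"] by (simp add: mult_ac)
      also have "\<dots> = of_bool (q' = a') * \<phi> a'"
        using \<phi> that by (simp add: stationary_distribution_def mult_ac)
      also have "\<dots> = (\<Sum>s\<le>S. x q' a' s)"
        using that assms(2) by (simp add: x_def)
      finally show ?thesis .
    qed
  qed
  moreover have "avg_delay A S Q (mean_arrivals A \<phi>) x = 1"
    using sum_x[of "\<lambda>q _ _. real q"] mean_arrivals_pos[OF assms(1) erg \<phi>]
    by (simp add: avg_delay_def mean_arrivals_def)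
  ultimately show ?thesis using that by blast
qed

section \<open>The region as the image of an affine section\<close>

lemma triple_sum_affine:
  fixes c x y :: "nat \<Rightarrow> nat \<Rightarrow> nat \<Rightarrow> real"
  shows "(\<Sum>q\<le>Q. \<Sum>a\<le>A. \<Sum>s\<le>S. c q a s * ((1 - t) * x q a s + t * y q a s))
    = (1 - t) * (\<Sum>q\<le>Q. \<Sum>a\<le>A. \<Sum>s\<le>S. c q a s * x q a s)
      + t * (\<Sum>q\<le>Q. \<Sum>a\<le>A. \<Sum>s\<le>S. c q a s * y q a s)"
  by (simp only: sum_distrib_left distrib_left sum.distrib mult.left_commute)

text \<open>The coefficient \<open>t\<close> is any real number, because the support-reducing ray
  leaves the segment between \<open>x\<close> and \<open>y\<close>; nonnegativity is therefore a
  premise.\<close>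

lemma frequencies_affine:
  assumes "A \<le> S" and x: "x \<in> frequencies A S Q \<gamma>" and y: "y \<in> frequencies A S Q \<gamma>"
    and nonneg: "\<And>q a s. q \<le> Q \<Longrightarrow> a \<le> A \<Longrightarrow> s \<le> S
      \<Longrightarrow> 0 \<le> (1 - t) * x q a s + t * y q a s"
  shows "(\<lambda>q a s. (1 - t) * x q a s + t * y q a s) \<in> frequencies A S Q \<gamma>"
proof -
  note iff = frequencies_iff[OF \<open>A \<le> S\<close>]
  show ?thesis
    unfolding iff
  proof (intro conjI allI impI)
    show "0 \<le> (1 - t) * x q a s + t * y q a s" if "q \<le> Q" "a \<le> A" "s \<le> S" for q a s
      using nonneg that .
    show "(1 - t) * x q a s + t * y q a s = 0"
      if "q \<le> Q" "a \<le> A" "s \<le> S" "s \<notin> feasible_rates A S Q q" for q a s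
      using x y that by (simp add: iff)
    show "(\<Sum>q\<le>Q. \<Sum>a\<le>A. \<Sum>s\<le>S. (1 - t) * x q a s + t * y q a s) = 1"
      using triple_sum_affine[of "\<lambda>_ _ _. 1" t x y S A Q] x y by (simp add: iff)
    show "(\<Sum>q\<le>Q. \<Sum>a\<le>A. \<Sum>s\<le>S.
          \<gamma> a a' * ((1 - t) * x q a s + t * y q a s) * of_bool (s + q' = q + a'))
        = (\<Sum>s\<le>S. (1 - t) * x q' a' s + t * y q' a' s)" if "q' \<le> Q" "a' \<le> A" for q' a'
    proof -
      define c where "c q a s = \<gamma> a a' * of_bool (s + q' = q + a')" for q a s
      have c: "\<gamma> a a' * w * of_bool (s + q' = q + a') = c q a s * w" for q a s w
        by (simp add: c_def)
      have "(\<Sum>q\<le>Q. \<Sum>a\<le>A. \<Sum>s\<le>S. c q a s * x q a s) = (\<Sum>s\<le>S. x q' a' s)"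
        "(\<Sum>q\<le>Q. \<Sum>a\<le>A. \<Sum>s\<le>S. c q a s * y q a s) = (\<Sum>s\<le>S. y q' a' s)"
        using x y that by (simp_all add: iff flip: c)
      then show ?thesis
        unfolding c triple_sum_affine by (simp only: sum.distrib sum_distrib_left)
    qed
  qed
qed

lemma power_delay_region_polytope:
  assumes "A \<le> S"
  obtains F where "finite F" "power_delay_region A S Q \<gamma> \<phi> P = convex hull F"
proof -
  let ?\<alpha> = "mean_arrivals A \<phi>"
  \<comment> \<open>The support argument needs a single index, so families become functions on
    triples. Their values outside the box \<open>?I\<close> are arbitrary, and elements of
    \<open>K\<close> are compared only on it.\<close>
  let ?c = "\<lambda>(z :: nat \<times> nat \<times> nat \<Rightarrow> real) q a s. z (q, a, s)"
  define K where "K = {z. ?c z \<in> frequencies A S Q \<gamma>}"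
  define h where "h z = (avg_power A S Q P (?c z), avg_delay A S Q ?\<alpha> (?c z))" for z
  let ?I = "{..Q} \<times> {..A} \<times> {..S}"
  have region: "power_delay_region A S Q \<gamma> \<phi> P = h ` K"
  proof (intro equalityI subsetI)
    fix w assume "w \<in> power_delay_region A S Q \<gamma> \<phi> P"
    then obtain x where x: "x \<in> frequencies A S Q \<gamma>"
      "w = (avg_power A S Q P x, avg_delay A S Q ?\<alpha> x)"
      unfolding power_delay_region_def by blast
    then have "(\<lambda>(q, a, s). x q a s) \<in> K" "w = h (\<lambda>(q, a, s). x q a s)"
      by (simp_all add: K_def h_def)
    then show "w \<in> h ` K" by blast
  qed (auto simp: power_delay_region_def h_def K_def)
  obtain F where "finite F" "h ` K = convex hull F"
  proof (rule affine_section_image_polytope[of ?I K h])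
    show "0 \<le> z i" if "z \<in> K" "i \<in> ?I" for z i
      using that \<open>A \<le> S\<close> by (auto simp: K_def frequencies_iff)
    show "sum z ?I = 1" if "z \<in> K" for z
      using that \<open>A \<le> S\<close> by (simp add: K_def frequencies_iff sum.cartesian_product)
    show "(\<lambda>i. (1 - t) * x i + t * y i) \<in> K"
      if "x \<in> K" "y \<in> K" "\<forall>i\<in>?I. 0 \<le> (1 - t) * x i + t * y i" for x y t
      using that frequencies_affine[OF \<open>A \<le> S\<close>, of "?c x" Q \<gamma> "?c y" t] by (simp add: K_def)
    show "h (\<lambda>i. (1 - t) * x i + t * y i) = (1 - t) *\<^sub>R h x + t *\<^sub>R h y" for x y t
      by (simp add: h_def avg_power_def avg_delay_def triple_sum_affine add_divide_distrib)
    show "h x = h y" if "\<forall>i\<in>?I. x i = y i" for x y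
      using that by (simp add: h_def avg_power_def avg_delay_def)
  qed simp
  then show ?thesis using that region by simp
qed

lemma tradeoff_curve_eq_weakly_pareto:
  "tradeoff_curve A S Q \<gamma> \<phi> P = weakly_pareto (power_delay_region A S Q \<gamma> \<phi> P)"
  by (simp add: tradeoff_curve_def weakly_pareto_def)

theorem theorem2:
  fixes A S Q :: nat
    and \<gamma> :: "nat \<Rightarrow> nat \<Rightarrow> real"
    and \<phi> P :: "nat \<Rightarrow> real"
  assumes "0 < A" and "0 < S" and "0 < Q"
    and "A \<le> S" and "A \<le> Q"
    and "ergodic_chain A \<gamma>"
    and "stationary_distribution A \<gamma> \<phi>"
    and "P 0 = 0"
    and "mono_on {..S} P"
    and "convex_seq_upto S P"
  shows "piecewise_linear_curve (tradeoff_curve A S Q \<gamma> \<phi> P)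
       \<and> decreasing_curve (tradeoff_curve A S Q \<gamma> \<phi> P)
       \<and> convex_curve (tradeoff_curve A S Q \<gamma> \<phi> P)"
proof -
  let ?R = "power_delay_region A S Q \<gamma> \<phi> P"
  note model = \<open>0 < A\<close> \<open>A \<le> S\<close> \<open>A \<le> Q\<close> \<open>ergodic_chain A \<gamma>\<close>
    \<open>stationary_distribution A \<gamma> \<phi>\<close>
  obtain F where F: "finite F" "?R = convex hull F"
    using power_delay_region_polytope[OF \<open>A \<le> S\<close>] .
  obtain x where x: "x \<in> frequencies A S Q \<gamma>" "avg_delay A S Q (mean_arrivals A \<phi>) x = 1"
    using minimal_delay_attained[OF model] .
  have "(avg_power A S Q P x, 1) \<in> ?R"
    using x by (force simp: power_delay_region_def)
  moreover have "1 \<le> d" if "(p, d) \<in> ?R" for p d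
    using that avg_delay_ge_1[OF model] by (auto simp: power_delay_region_def)
  moreover have "p = avg_power A S Q P x" if "(p, 1) \<in> ?R" for p
    using that x avg_power_of_minimal_delay[OF model] by (auto simp: power_delay_region_def)
  ultimately show ?thesis
    unfolding tradeoff_curve_eq_weakly_pareto F(2) by (rule weakly_pareto_polytope[OF F(1)])
qed

end
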